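(* Harmonicity of the Weyl tensor and zero radial Weyl curvature do not imply one another, even for multiply warped products with flat fibers. That is: there exists a multiply warped product $I\times_{h_1}N_1\times\cdots\times_{h_k}N_k$ over an open interval, of dimension $n\ge4$ and with all fibers flat, whose Weyl tensor is harmonic but for which $W(\partial_s,\cdot,\cdot,\cdot)$ does not vanish identically; and there exists a multiply warped product over an open interval, of dimension $n\ge4$ and with all fibers flat, for which $W(\partial_s,\cdot,\cdot,\cdot)=0$ but whose Weyl tensor is not harmonic.
   Context: A multiply warped product over an interval is $M^n=I\times_{h_1}N_1^{r_1}\times\cdots\times_{h_k}N_k^{r_k}$, $n=1+\sum_i r_i$, with metric $g=\mathrm{d}s^2+\sum_{i=1}^k h_i(s)^2g_{N_i}$, where $I$ is a connected open interval with coordinate $s$, each $(N_i,g_{N_i})$ is a connected Riemannian manifold, and each $h_i:I\to(0,\infty)$ is smooth; fibers whose warping functions are proportional by a positive constant are combined, so the $h_i$ are pairwise nonproportional. $W$ is the Weyl tensor of $g$. "Harmonic Weyl tensor" means $\delta W=0$ (divergence-free), which for $n\ge4$ is equivalent to vanishing of the Cotton tensor. "Zero radial Weyl curvature" means $W(\partial_s,\cdot,\cdot,\cdot)=0$. *)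

theory Defs
  imports "HOL-Analysis.Analysis"
begin

text \<open>
  Points of \<open>\<real>\<^sup>n\<close> are the elements of \<^const>\<open>Euclidean_space\<close> \<open>n\<close>, that is, sequences
  \<open>nat \<Rightarrow> real\<close> supported on \<open>{..<n}\<close>; this allows the dimension to be an ordinary variable.
  Coordinate indices run from \<open>0\<close> to \<open>n - 1\<close>, and tensor components are only meaningful for
  indices in this range.
\<close>

definition pd :: "nat \<Rightarrow> ((nat \<Rightarrow> real) \<Rightarrow> real) \<Rightarrow> (nat \<Rightarrow> real) \<Rightarrow> real" where
  "pd i f x = deriv (\<lambda>t. f (x(i := t))) (x i)"

text \<open>Smoothness on an open set: all iterated partial derivatives exist and are continuous.\<close>

definition smooth_on :: "nat \<Rightarrow> (nat \<Rightarrow> real) set \<Rightarrow> ((nat \<Rightarrow> real) \<Rightarrow> real) \<Rightarrow> bool" where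
  "smooth_on n U f \<longleftrightarrow>
     (\<forall>is. set is \<subseteq> {..<n} \<longrightarrow>
        continuous_map (subtopology (Euclidean_space n) U) euclideanreal (foldr pd is f) \<and>
        (\<forall>x\<in>U. \<forall>i<n. (\<lambda>t. foldr pd is f (x(i := t))) field_differentiable (at (x i))))"

definition smooth_real_on :: "real set \<Rightarrow> (real \<Rightarrow> real) \<Rightarrow> bool" where
  "smooth_real_on I f \<longleftrightarrow> (\<forall>m. \<forall>s\<in>I. (deriv ^^ m) f field_differentiable (at s))"


section \<open>Riemannian manifolds\<close>

text \<open>
  A manifold is given by a topology and an indexed smooth atlas; the chart with index \<open>c\<close> is
  \<open>cmap M c\<close> on \<open>cdom M c\<close>. The metric is given by its components \<open>gcomp M c x i j\<close> in each
  chart, at the point with coordinates \<open>x\<close>.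
\<close>

record ('a, 'c) riem =
  mtop :: "'a topology"
  mdim :: nat
  charts :: "'c set"
  cdom :: "'c \<Rightarrow> 'a set"
  cmap :: "'c \<Rightarrow> 'a \<Rightarrow> (nat \<Rightarrow> real)"
  gcomp :: "'c \<Rightarrow> (nat \<Rightarrow> real) \<Rightarrow> nat \<Rightarrow> nat \<Rightarrow> real"

definition cimg :: "('a, 'c) riem \<Rightarrow> 'c \<Rightarrow> (nat \<Rightarrow> real) set" where
  "cimg M c = cmap M c ` cdom M c"

definition transition :: "('a, 'c) riem \<Rightarrow> 'c \<Rightarrow> 'c \<Rightarrow> (nat \<Rightarrow> real) \<Rightarrow> (nat \<Rightarrow> real)" where
  "transition M c d x = cmap M d (inv_into (cdom M c) (cmap M c) x)"

definition second_countable_top :: "'a topology \<Rightarrow> bool" where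
  "second_countable_top X \<longleftrightarrow>
     (\<exists>\<B>. countable \<B> \<and> (\<forall>V\<in>\<B>. openin X V) \<and>
        (\<forall>U x. openin X U \<and> x \<in> U \<longrightarrow> (\<exists>V\<in>\<B>. x \<in> V \<and> V \<subseteq> U)))"

definition smooth_manifold :: "('a, 'c) riem \<Rightarrow> bool" where
  "smooth_manifold M \<longleftrightarrow>
     Hausdorff_space (mtop M) \<and> second_countable_top (mtop M) \<and>
     (\<Union>c\<in>charts M. cdom M c) = topspace (mtop M) \<and>
     (\<forall>c\<in>charts M.
        openin (mtop M) (cdom M c) \<and>
        openin (Euclidean_space (mdim M)) (cimg M c) \<and>
        homeomorphic_map (subtopology (mtop M) (cdom M c))
          (subtopology (Euclidean_space (mdim M)) (cimg M c)) (cmap M c)) \<and>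
     (\<forall>c\<in>charts M. \<forall>d\<in>charts M. \<forall>a<mdim M.
        smooth_on (mdim M) (cmap M c ` (cdom M c \<inter> cdom M d)) (\<lambda>x. transition M c d x a))"

definition metric_tensor :: "('a, 'c) riem \<Rightarrow> bool" where
  "metric_tensor M \<longleftrightarrow>
     (\<forall>c\<in>charts M.
        (\<forall>i<mdim M. \<forall>j<mdim M. smooth_on (mdim M) (cimg M c) (\<lambda>x. gcomp M c x i j)) \<and>
        (\<forall>x\<in>cimg M c.
           (\<forall>i<mdim M. \<forall>j<mdim M. gcomp M c x i j = gcomp M c x j i) \<and>
           (\<forall>v. (\<exists>i<mdim M. v i \<noteq> 0) \<longrightarrow>
              0 < (\<Sum>i<mdim M. \<Sum>j<mdim M. gcomp M c x i j * v i * v j)))) \<and>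
     (\<forall>c\<in>charts M. \<forall>d\<in>charts M. \<forall>p\<in>cdom M c \<inter> cdom M d. \<forall>i<mdim M. \<forall>j<mdim M.
        gcomp M c (cmap M c p) i j =
          (\<Sum>a<mdim M. \<Sum>b<mdim M.
             pd i (\<lambda>x. transition M c d x a) (cmap M c p) *
             pd j (\<lambda>x. transition M c d x b) (cmap M c p) *
             gcomp M d (cmap M d p) a b))"

definition connected_riemannian_manifold :: "('a, 'c) riem \<Rightarrow> bool" where
  "connected_riemannian_manifold M \<longleftrightarrow>
     smooth_manifold M \<and> metric_tensor M \<and>
     connected_space (mtop M) \<and> topspace (mtop M) \<noteq> {}"


section \<open>Curvature in local coordinates\<close>

type_synonym local_metric = "(nat \<Rightarrow> real) \<Rightarrow> nat \<Rightarrow> nat \<Rightarrow> real"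

definition mat_inv :: "nat \<Rightarrow> (nat \<Rightarrow> nat \<Rightarrow> real) \<Rightarrow> nat \<Rightarrow> nat \<Rightarrow> real" where
  "mat_inv n A = (THE B.
     (\<forall>i<n. \<forall>j<n. (\<Sum>k<n. B i k * A k j) = (if i = j then 1 else 0)) \<and>
     (\<forall>i j. \<not> (i < n \<and> j < n) \<longrightarrow> B i j = 0))"

definition ginv :: "nat \<Rightarrow> local_metric \<Rightarrow> nat \<Rightarrow> nat \<Rightarrow> (nat \<Rightarrow> real) \<Rightarrow> real" where
  "ginv n g i j x = mat_inv n (g x) i j"

text \<open>\<open>christoffel n g k i j\<close> is \<open>\<Gamma>\<^sup>k\<^sub>i\<^sub>j\<close>.\<close>

definition christoffel :: "nat \<Rightarrow> local_metric \<Rightarrow> nat \<Rightarrow> nat \<Rightarrow> nat \<Rightarrow> (nat \<Rightarrow> real) \<Rightarrow> real" where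
  "christoffel n g k i j x =
     (1/2) * (\<Sum>l<n. ginv n g k l x *
        (pd i (\<lambda>y. g y j l) x + pd j (\<lambda>y. g y i l) x - pd l (\<lambda>y. g y i j) x))"

text \<open>
  \<open>riem_up n g l i j k\<close> is the coefficient of \<open>\<partial>\<^sub>l\<close> in \<open>R(\<partial>\<^sub>i, \<partial>\<^sub>j)\<partial>\<^sub>k\<close>, where
  \<open>R(X, Y)Z = \<nabla>\<^sub>X\<nabla>\<^sub>YZ - \<nabla>\<^sub>Y\<nabla>\<^sub>XZ - \<nabla>\<^bsub>[X,Y]\<^esub>Z\<close>, and
  \<open>riem_dn n g i j k l = g(R(\<partial>\<^sub>i, \<partial>\<^sub>j)\<partial>\<^sub>k, \<partial>\<^sub>l)\<close>. With these conventions the round unit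
  sphere has \<open>riem_dn n g i j k l = g\<^sub>i\<^sub>l g\<^sub>j\<^sub>k - g\<^sub>i\<^sub>k g\<^sub>j\<^sub>l\<close>.
\<close>

definition riem_up ::
  "nat \<Rightarrow> local_metric \<Rightarrow> nat \<Rightarrow> nat \<Rightarrow> nat \<Rightarrow> nat \<Rightarrow> (nat \<Rightarrow> real) \<Rightarrow> real" where
  "riem_up n g l i j k x =
     pd i (christoffel n g l j k) x - pd j (christoffel n g l i k) x +
     (\<Sum>m<n. christoffel n g l i m x * christoffel n g m j k x -
             christoffel n g l j m x * christoffel n g m i k x)"

definition riem_dn ::
  "nat \<Rightarrow> local_metric \<Rightarrow> nat \<Rightarrow> nat \<Rightarrow> nat \<Rightarrow> nat \<Rightarrow> (nat \<Rightarrow> real) \<Rightarrow> real" where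
  "riem_dn n g i j k l x = (\<Sum>m<n. g x l m * riem_up n g m i j k x)"

definition ricci :: "nat \<Rightarrow> local_metric \<Rightarrow> nat \<Rightarrow> nat \<Rightarrow> (nat \<Rightarrow> real) \<Rightarrow> real" where
  "ricci n g j k x = (\<Sum>i<n. riem_up n g i i j k x)"

definition scal :: "nat \<Rightarrow> local_metric \<Rightarrow> (nat \<Rightarrow> real) \<Rightarrow> real" where
  "scal n g x = (\<Sum>j<n. \<Sum>k<n. ginv n g j k x * ricci n g j k x)"

definition weyl ::
  "nat \<Rightarrow> local_metric \<Rightarrow> nat \<Rightarrow> nat \<Rightarrow> nat \<Rightarrow> nat \<Rightarrow> (nat \<Rightarrow> real) \<Rightarrow> real" where
  "weyl n g i j k l x =
     riem_dn n g i j k l x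
     - (ricci n g i l x * g x j k + ricci n g j k x * g x i l
        - ricci n g i k x * g x j l - ricci n g j l x * g x i k) / (real n - 2)
     + scal n g x * (g x i l * g x j k - g x i k * g x j l) / ((real n - 1) * (real n - 2))"

text \<open>\<open>cov_weyl n g p i j k l\<close> is \<open>(\<nabla>\<^sub>pW)\<^sub>i\<^sub>j\<^sub>k\<^sub>l\<close>.\<close>

definition cov_weyl ::
  "nat \<Rightarrow> local_metric \<Rightarrow> nat \<Rightarrow> nat \<Rightarrow> nat \<Rightarrow> nat \<Rightarrow> nat \<Rightarrow> (nat \<Rightarrow> real) \<Rightarrow> real" where
  "cov_weyl n g p i j k l x =
     pd p (weyl n g i j k l) x
     - (\<Sum>m<n. christoffel n g m p i x * weyl n g m j k l x
             + christoffel n g m p j x * weyl n g i m k l x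
             + christoffel n g m p k x * weyl n g i j m l x
             + christoffel n g m p l x * weyl n g i j k m x)"

definition div_weyl ::
  "nat \<Rightarrow> local_metric \<Rightarrow> nat \<Rightarrow> nat \<Rightarrow> nat \<Rightarrow> (nat \<Rightarrow> real) \<Rightarrow> real" where
  "div_weyl n g j k l x = (\<Sum>p<n. \<Sum>i<n. ginv n g p i x * cov_weyl n g p i j k l x)"

definition flat :: "('a, 'c) riem \<Rightarrow> bool" where
  "flat M \<longleftrightarrow>
     (\<forall>c\<in>charts M. \<forall>x\<in>cimg M c.
        \<forall>i<mdim M. \<forall>j<mdim M. \<forall>k<mdim M. \<forall>l<mdim M.
          riem_dn (mdim M) (gcomp M c) i j k l x = 0)"

definition harmonic_weyl :: "('a, 'c) riem \<Rightarrow> bool" where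
  "harmonic_weyl M \<longleftrightarrow>
     (\<forall>c\<in>charts M. \<forall>x\<in>cimg M c.
        \<forall>j<mdim M. \<forall>k<mdim M. \<forall>l<mdim M. div_weyl (mdim M) (gcomp M c) j k l x = 0)"


section \<open>Multiply warped products\<close>

text \<open>
  The coordinate \<open>s\<close> of the interval has index \<open>0\<close>, and the coordinates of the \<open>i\<close>-th fiber
  (\<open>i < k\<close>) have the indices in \<open>block N i\<close>.
\<close>

definition offset :: "(nat \<Rightarrow> ('a, 'c) riem) \<Rightarrow> nat \<Rightarrow> nat" where
  "offset N i = 1 + (\<Sum>j<i. mdim (N j))"

definition block :: "(nat \<Rightarrow> ('a, 'c) riem) \<Rightarrow> nat \<Rightarrow> nat set" where
  "block N i = {offset N i ..< offset N i + mdim (N i)}"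

definition fiber_coords ::
  "(nat \<Rightarrow> ('a, 'c) riem) \<Rightarrow> nat \<Rightarrow> (nat \<Rightarrow> real) \<Rightarrow> (nat \<Rightarrow> real)" where
  "fiber_coords N i x = (\<lambda>a. if a < mdim (N i) then x (offset N i + a) else 0)"

text \<open>
  The atlas consists of the products of charts of the fibers (with \<open>s\<close> on the interval). The
  blocks are disjoint and do not contain \<open>0\<close>, so at most one summand is nonzero in each of the
  sums over the fibers below.
\<close>

definition multiply_warped_product ::
  "real set \<Rightarrow> nat \<Rightarrow> (nat \<Rightarrow> ('a, 'c) riem) \<Rightarrow> (nat \<Rightarrow> real \<Rightarrow> real) \<Rightarrow>
     (real \<times> (nat \<Rightarrow> 'a), nat \<Rightarrow> 'c) riem" where
  "multiply_warped_product I k N h =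
     \<lparr>mtop = prod_topology (top_of_set I) (product_topology (\<lambda>i. mtop (N i)) {..<k}),
      mdim = 1 + (\<Sum>i<k. mdim (N i)),
      charts = PiE {..<k} (\<lambda>i. charts (N i)),
      cdom = (\<lambda>c. I \<times> PiE {..<k} (\<lambda>i. cdom (N i) (c i))),
      cmap = (\<lambda>c (s, p) m.
        if m = 0 then s
        else (\<Sum>i<k. if m \<in> block N i then cmap (N i) (c i) (p i) (m - offset N i) else 0)),
      gcomp = (\<lambda>c x m l.
        (if m = 0 \<and> l = 0 then 1 else 0) +
        (\<Sum>i<k. if m \<in> block N i \<and> l \<in> block N i
               then (h i (x 0))\<^sup>2 *
                    gcomp (N i) (c i) (fiber_coords N i x) (m - offset N i) (l - offset N i)
               else 0))\<rparr>"

definition warped_product_data ::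
  "real set \<Rightarrow> nat \<Rightarrow> (nat \<Rightarrow> ('a, 'c) riem) \<Rightarrow> (nat \<Rightarrow> real \<Rightarrow> real) \<Rightarrow> bool" where
  "warped_product_data I k N h \<longleftrightarrow>
     open I \<and> connected I \<and> I \<noteq> {} \<and>
     (\<forall>i<k. connected_riemannian_manifold (N i) \<and> 1 \<le> mdim (N i) \<and>
            smooth_real_on I (h i) \<and> (\<forall>s\<in>I. 0 < h i s)) \<and>
     (\<forall>i<k. \<forall>j<k. i \<noteq> j \<longrightarrow> \<not> (\<exists>a>0. \<forall>s\<in>I. h i s = a * h j s))"

text \<open>
  \<open>W(\<partial>\<^sub>s, \<cdot>, \<cdot>, \<cdot>) = 0\<close>: in every product chart \<open>\<partial>\<^sub>s\<close> is the coordinate field with index \<open>0\<close>.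
\<close>

definition zero_radial_weyl ::
  "real set \<Rightarrow> nat \<Rightarrow> (nat \<Rightarrow> ('a, 'c) riem) \<Rightarrow> (nat \<Rightarrow> real \<Rightarrow> real) \<Rightarrow> bool" where
  "zero_radial_weyl I k N h \<longleftrightarrow>
     (let M = multiply_warped_product I k N h in
      \<forall>c\<in>charts M. \<forall>x\<in>cimg M c. \<forall>i<mdim M. \<forall>j<mdim M. \<forall>l<mdim M.
        weyl (mdim M) (gcomp M c) 0 i j l x = 0)"

text \<open>
  A connected manifold has at most continuum many points and a countable atlas, so
  this instance of the type parameters still covers all connected Riemannian manifolds up to
  isometry.
\<close>

type_synonym fiber = "(nat \<Rightarrow> real, nat) riem"

end

theory Submission
  imports Defs
begin

text \<open>
  Both examples are metrics \<open>ds\<^sup>2 + e\<^bsup>2s\<^esup> (dx\<^sub>1\<^sup>2 + dx\<^sub>2\<^sup>2) + e\<^bsup>2bs\<^esup> (dx\<^sub>3\<^sup>2 + dx\<^sub>4\<^sup>2)\<close> on \<open>\<real>\<^sup>5\<close>, that is,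
  warped products of the line with two Euclidean planes.

  For \<open>b = 0\<close> this is \<open>H\<^sup>3 \<times> \<real>\<^sup>2\<close>, a symmetric space: its Weyl tensor is parallel and in particular
  harmonic. The radial planes tangent to \<open>H\<^sup>3\<close> have Weyl eigenvalue \<open>- 1/6\<close>.

  For the converse, zero radial Weyl curvature forces \<open>W = 0\<close> in dimension \<open>4\<close>, since there the
  vanishing trace recovers all other components from the radial ones; five dimensions leave
  room. With exponents \<open>w\<^sub>i\<close> of sum \<open>A\<close> in dimension \<open>n\<close>, the radial part vanishes when all \<open>w\<^sub>i\<close> are roots of one
  quadratic polynomial with root sum \<open>A / (n - 2)\<close>. For two exponents \<open>1\<close> and \<open>b\<close>, each of
  multiplicity two, this says \<open>3 (1 + b) = 2 (1 + b)\<close>, so \<open>b = - 1\<close>. That metric has Weyl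
  eigenvalue \<open>- 4/3\<close> on the fibers and \<open>2/3\<close> on the mixed planes, and it is not harmonic.

  Both claims are read off from two general formulas for a diagonal metric with components
  \<open>exp (2 w\<^sub>i x\<^sub>0)\<close> and \<open>w\<^sub>0 = 0\<close>. Its Weyl tensor is diagonal on the coordinate bivectors, with
  constant eigenvalues \<open>\<omega>\<^sub>i\<^sub>j\<close> that are quadratic expressions in the exponents (\<open>weyl_eq\<close>), and its
  divergence is governed by the sums \<open>\<Sum>\<^sub>p w\<^sub>p (\<omega>\<^sub>0\<^sub>j - \<omega>\<^sub>p\<^sub>j)\<close> over \<open>p \<noteq> j\<close> (\<open>div_weyl_eq\<close>).
\<close>

section \<open>Diagonal metrics with exponential coefficients\<close>

lemma pd_exp_first_coord:
  "pd p (\<lambda>y. a + c * exp (b * y 0)) x = (if p = 0 then c * (b * exp (b * x 0)) else 0)"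
proof (cases "p = 0")
  case True
  have "((\<lambda>t. a + c * exp (b * t)) has_real_derivative c * (b * exp (b * x 0))) (at (x 0))"
    by (auto intro!: derivative_eq_intros)
  with True show ?thesis by (simp add: pd_def DERIV_imp_deriv)
qed (simp add: pd_def)

lemma sum_diagonal:
  fixes a X :: "nat \<Rightarrow> real"
  assumes "k < n"
  shows "(\<Sum>l<n. (if k = l then a l else 0) * X l) = a k * X k"
    and "(\<Sum>l<n. X l * (if l = k then a l else 0)) = a k * X k"
  using assms by (simp_all add: if_distrib[of "\<lambda>u. u * _"] if_distrib[of "\<lambda>u. _ * u"] cong: if_cong)

text \<open>
  The tensor components of a metric on an open part of \<open>\<real>\<^sup>n\<close> are constrained for indices below
  \<open>n\<close> only, because the components of a warped product vanish beyond its dimension. The condition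
  \<open>w 0 = 0\<close> says that \<open>\<partial>\<^sub>0\<close> is a unit field; it makes the formulas below uniform in the
  indices, since a factor \<open>w i\<close> removes the index \<open>0\<close> from every sum.
\<close>

locale exponential_diagonal_metric =
  fixes n :: nat and w :: "nat \<Rightarrow> real" and g :: local_metric
  assumes w_0: "w 0 = 0"
    and g_eq: "\<And>x i j. i < n \<Longrightarrow> j < n \<Longrightarrow> g x i j = (if i = j then exp (2 * w i * x 0) else 0)"
begin

lemma ginv_eq:
  assumes "i < n" "j < n"
  shows "ginv n g i j x = (if i = j then exp (- (2 * w i * x 0)) else 0)"
proof -
  define B where "B = (\<lambda>i j. if i < n \<and> j < n \<and> i = j then exp (- (2 * w i * x 0)) else 0)"
  have row: "(\<Sum>k<n. C i k * g x k j) = C i j * exp (2 * w j * x 0)"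
    if "j < n" for C :: "nat \<Rightarrow> nat \<Rightarrow> real" and i j
  proof -
    have "(\<Sum>k<n. C i k * g x k j) = (\<Sum>k<n. C i k * (if k = j then exp (2 * w k * x 0) else 0))"
      using that by (intro sum.cong) (auto simp: g_eq)
    then show ?thesis using that by (simp add: sum_diagonal)
  qed
  have "mat_inv n (g x) = B"
    unfolding mat_inv_def
  proof (rule the_equality)
    show "(\<forall>i<n. \<forall>j<n. (\<Sum>k<n. B i k * g x k j) = (if i = j then 1 else 0)) \<and>
      (\<forall>i j. \<not> (i < n \<and> j < n) \<longrightarrow> B i j = 0)"
      by (simp add: row) (auto simp: B_def exp_minus)
  next
    fix C
    assume C: "(\<forall>i<n. \<forall>j<n. (\<Sum>k<n. C i k * g x k j) = (if i = j then 1 else 0)) \<and>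
      (\<forall>i j. \<not> (i < n \<and> j < n) \<longrightarrow> C i j = 0)"
    show "C = B"
    proof (intro ext)
      fix i j
      show "C i j = B i j"
      proof (cases "i < n \<and> j < n")
        case True
        then have "C i j * exp (2 * w j * x 0) = (if i = j then 1 else 0)" using C by (simp add: row)
        then show ?thesis using True by (auto simp: B_def exp_minus field_simps)
      next
        case False
        with C show ?thesis by (auto simp: B_def)
      qed
    qed
  qed
  with assms show ?thesis by (simp add: ginv_def B_def)
qed

lemma pd_g:
  assumes "i < n" "j < n"
  shows "pd p (\<lambda>y. g y i j) x = (if p = 0 \<and> i = j then 2 * w i * exp (2 * w i * x 0) else 0)"
proof -
  have "(\<lambda>y. g y i j) = (\<lambda>y. 0 + (if i = j then 1 else 0) * exp (2 * w i * y 0))"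
    using assms by (auto simp: g_eq)
  then show ?thesis by (simp add: pd_exp_first_coord[of p 0, simplified])
qed

lemma christoffel_eq:
  assumes "k < n" "i < n" "j < n"
  shows "christoffel n g k i j x =
    (if i = 0 \<and> j = k then w k else 0) + (if j = 0 \<and> i = k then w k else 0)
    - (if k = 0 \<and> i = j then w i * exp (2 * w i * x 0) else 0)"
proof -
  have "christoffel n g k i j x = 1/2 * (\<Sum>l<n. (if k = l then exp (- (2 * w l * x 0)) else 0) *
     (pd i (\<lambda>y. g y j l) x + pd j (\<lambda>y. g y i l) x - pd l (\<lambda>y. g y i j) x))"
    unfolding christoffel_def using assms(1)
    by (intro arg_cong[where f="\<lambda>u. 1/2 * u"] sum.cong) (auto simp: ginv_eq)
  also have "\<dots> = 1/2 * (exp (- (2 * w k * x 0)) *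
     (pd i (\<lambda>y. g y j k) x + pd j (\<lambda>y. g y i k) x - pd k (\<lambda>y. g y i j) x))"
    using assms(1) by (simp add: sum_diagonal)
  finally show ?thesis using assms w_0 by (auto simp: pd_g exp_minus field_simps)
qed

lemma sum_christoffel:
  assumes "i < n" "l < n"
  shows "(\<Sum>m<n. christoffel n g l i m x * X m) =
    (if i = 0 then w l * X l else 0) + (if i = l then w l * X 0 else 0)
    - (if l = 0 then w i * exp (2 * w i * x 0) * X i else 0)"
proof -
  have n: "0 < n" using assms by simp
  have "(\<Sum>m<n. christoffel n g l i m x * X m) =
     (\<Sum>m<n. (if m = l then (if i = 0 then w l else 0) * X m else 0)
       + (if m = 0 then (if i = l then w l else 0) * X m else 0)
       - (if m = i then (if l = 0 then w i * exp (2 * w i * x 0) else 0) * X m else 0))"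
    using assms by (intro sum.cong) (auto simp: christoffel_eq algebra_simps)
  then show ?thesis using assms n by (simp add: sum.distrib sum_subtractf)
qed

lemma sum_christoffel_upper:
  assumes "p < n" "i < n"
  shows "(\<Sum>m<n. christoffel n g m p i x * X m) =
    (if p = 0 then w i * X i else 0) + (if i = 0 then w p * X p else 0)
    - (if p = i then w p * exp (2 * w p * x 0) * X 0 else 0)"
proof -
  have n: "0 < n" using assms by simp
  have "(\<Sum>m<n. christoffel n g m p i x * X m) =
     (\<Sum>m<n. (if m = i then (if p = 0 then w i else 0) * X m else 0)
       + (if m = p then (if i = 0 then w p else 0) * X m else 0)
       - (if m = 0 then (if p = i then w i * exp (2 * w i * x 0) else 0) * X m else 0))"
    using assms by (intro sum.cong) (auto simp: christoffel_eq algebra_simps)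
  then show ?thesis using assms n by (simp add: sum.distrib sum_subtractf)
qed

text \<open>
  The curvature operator is diagonal on the coordinate bivectors. A warping function
  \<open>h = exp (a s)\<close> has \<open>h'' / h = a\<^sup>2\<close> and \<open>h' / h = a\<close>, so the coordinate planes have
  sectional curvatures \<open>- (w j)\<^sup>2\<close> (radial) and \<open>- w i * w j\<close> (along the fibers); the product term
  drops out for a radial plane because \<open>w 0 = 0\<close>.
\<close>

definition sec_curv :: "nat \<Rightarrow> nat \<Rightarrow> real" where
  "sec_curv i j = - (w i * w j + (if i = 0 then (w j)\<^sup>2 else 0) + (if j = 0 then (w i)\<^sup>2 else 0))"

lemma sec_curv_commute: "sec_curv i j = sec_curv j i" by (simp add: sec_curv_def)

text \<open>
  The coordinate fields diagonalize the Ricci tensor as well, being orthogonal directions whose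
  planes diagonalize the curvature operator; the eigenvalue is the sum of the sectional
  curvatures of the planes through the direction.
\<close>

definition ricci_eigenvalue :: "nat \<Rightarrow> real" where
  "ricci_eigenvalue i = (\<Sum>j\<in>{..<n} - {i}. sec_curv i j)"

definition scalar_curv :: real where
  "scalar_curv = (\<Sum>i<n. ricci_eigenvalue i)"

definition weyl_eigenvalue :: "nat \<Rightarrow> nat \<Rightarrow> real" where
  "weyl_eigenvalue i j = sec_curv i j - (ricci_eigenvalue i + ricci_eigenvalue j) / (real n - 2)
     + scalar_curv / ((real n - 1) * (real n - 2))"

lemma weyl_eigenvalue_commute: "weyl_eigenvalue i j = weyl_eigenvalue j i"
  by (simp add: weyl_eigenvalue_def sec_curv_commute add.commute)

lemma pd_christoffel:
  assumes "k < n" "i < n" "j < n"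
  shows "pd p (christoffel n g k i j) x =
    - (if p = 0 \<and> k = 0 \<and> i = j then 2 * (w i)\<^sup>2 * exp (2 * w i * x 0) else 0)"
proof -
  define a where "a = (if i = 0 \<and> j = k then w k else 0) + (if j = 0 \<and> i = k then w k else 0)"
  define c where "c = (if k = 0 \<and> i = j then - w i else 0)"
  have "christoffel n g k i j = (\<lambda>y. a + c * exp (2 * w i * y 0))"
    using assms by (auto simp: christoffel_eq a_def c_def)
  then have "pd p (christoffel n g k i j) x = (if p = 0 then c * (2 * w i * exp (2 * w i * x 0)) else 0)"
    by (simp only: pd_exp_first_coord)
  then show ?thesis by (simp add: c_def power2_eq_square)
qed

text \<open>
  All components depend on the coordinate \<open>0\<close> only, and each Christoffel symbol involves the
  index \<open>0\<close>. After the contraction over \<open>m\<close>, a term thus survives only when one of \<open>i\<close>, \<open>j\<close>, \<open>l\<close> is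
  \<open>0\<close> or two of them coincide, which leaves the finitely many cases of the proof.
\<close>

lemma riem_up_eq:
  assumes "l < n" "i < n" "j < n" "k < n"
  shows "riem_up n g l i j k x =
    sec_curv i j * ((if i = l then g x j k else 0) - (if j = l then g x i k else 0))"
proof -
  have n: "0 < n" using assms by simp
  define e where "e m = exp (2 * w m * x 0)" for m
  have e_0: "e 0 = 1" by (simp add: e_def w_0)
  have "riem_up n g l i j k x =
    (if j = 0 \<and> l = 0 \<and> i = k then 2 * (w i)\<^sup>2 * e i else 0)
    - (if i = 0 \<and> l = 0 \<and> j = k then 2 * (w j)\<^sup>2 * e j else 0)
    + (if i = 0 then w l * christoffel n g l j k x else 0)
    + (if i = l then w l * christoffel n g 0 j k x else 0)
    - (if l = 0 then w i * e i * christoffel n g i j k x else 0)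
    - (if j = 0 then w l * christoffel n g l i k x else 0)
    - (if j = l then w l * christoffel n g 0 i k x else 0)
    + (if l = 0 then w j * e j * christoffel n g j i k x else 0)"
    unfolding riem_up_def sum_subtractf e_def
    using assms by (simp add: pd_christoffel sum_christoffel split del: if_split)
  moreover have "christoffel n g a b c x = (if b = 0 \<and> c = a then w a else 0)
      + (if c = 0 \<and> b = a then w a else 0) - (if a = 0 \<and> b = c then w b * e b else 0)"
    if "a < n" "b < n" "c < n" for a b c
    using that by (simp add: christoffel_eq e_def)
  moreover have "g x a b = (if a = b then e a else 0)" if "a < n" "b < n" for a b
    using that by (simp add: g_eq e_def)
  ultimately show ?thesis using assms n
    by (simp add: sec_curv_def split del: if_split)
       (cases "i = j"; cases "l = 0"; cases "i = 0"; cases "j = 0"; auto simp: w_0 e_0 power2_eq_square)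
qed

lemma riem_dn_eq:
  assumes "i < n" "j < n" "k < n" "l < n"
  shows "riem_dn n g i j k l x = sec_curv i j * (g x i l * g x j k - g x i k * g x j l)"
proof -
  have "riem_dn n g i j k l x = (\<Sum>m<n. (if l = m then exp (2 * w m * x 0) else 0) * riem_up n g m i j k x)"
    unfolding riem_dn_def using assms by (intro sum.cong) (auto simp: g_eq)
  also have "\<dots> = exp (2 * w l * x 0) * riem_up n g l i j k x"
    using assms by (simp add: sum_diagonal)
  finally show ?thesis using assms by (auto simp: riem_up_eq g_eq)
qed

lemma ricci_eq:
  assumes "j < n" "k < n"
  shows "ricci n g j k x = ricci_eigenvalue j * g x j k"
proof -
  have "ricci n g j k x = (\<Sum>i<n. if i = j then 0 else sec_curv j i * g x j k)"
    unfolding ricci_def using assms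
    by (intro sum.cong) (auto simp: riem_up_eq sec_curv_commute g_eq)
  also have "\<dots> = (\<Sum>i\<in>{..<n} - {j}. sec_curv j i * g x j k)"
    by (intro sum.mono_neutral_cong_right) auto
  finally show ?thesis by (simp add: ricci_eigenvalue_def sum_distrib_right)
qed

lemma scal_eq: "scal n g x = scalar_curv"
proof -
  have "(\<Sum>k<n. ginv n g j k x * ricci n g j k x) = ricci_eigenvalue j" if "j < n" for j
  proof -
    have "(\<Sum>k<n. ginv n g j k x * ricci n g j k x) =
      (\<Sum>k<n. (if j = k then exp (- (2 * w k * x 0)) else 0) * (ricci_eigenvalue j * g x j k))"
      using that by (intro sum.cong) (auto simp: ginv_eq ricci_eq)
    then show ?thesis using that by (simp add: sum_diagonal g_eq exp_minus)
  qed
  then show ?thesis by (simp add: scal_def scalar_curv_def)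
qed

text \<open>
  The Kulkarni--Nomizu product of the Ricci tensor with \<open>g\<close> scales the bivector of the
  \<open>(i, j)\<close> plane by the sum of the two Ricci eigenvalues.
\<close>

lemma weyl_eq:
  assumes "i < n" "j < n" "k < n" "l < n"
  shows "weyl n g i j k l x = weyl_eigenvalue i j * (g x i l * g x j k - g x i k * g x j l)"
  unfolding weyl_def divide_inverse weyl_eigenvalue_def using assms
  by (simp add: riem_dn_eq ricci_eq scal_eq) (simp only: algebra_simps)

lemma pd_weyl:
  assumes "i < n" "j < n" "k < n" "l < n"
  shows "pd p (weyl n g i j k l) x = (if p = 0 then 2 * (w i + w j) * weyl n g i j k l x else 0)"
proof -
  have "weyl n g i j k l = (\<lambda>y. 0 + (weyl_eigenvalue i j * ((if i = l \<and> j = k then 1 else 0) - (if i = k \<and> j = l then 1 else 0)))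
     * exp (2 * (w i + w j) * y 0))"
  proof
    fix y :: "nat \<Rightarrow> real"
    define e where "e m = exp (2 * w m * y 0)" for m
    have e: "exp (2 * (w i + w j) * y 0) = e i * e j"
      by (simp add: e_def exp_add[symmetric] algebra_simps)
    have g: "g y a b = (if a = b then e a else 0)" if "a < n" "b < n" for a b
      using that by (simp add: g_eq e_def)
    have "g y i l * g y j k = (if i = l \<and> j = k then 1 else 0) * (e i * e j)"
      using assms by (cases "i = l"; cases "j = k"; simp add: g)
    moreover have "g y i k * g y j l = (if i = k \<and> j = l then 1 else 0) * (e i * e j)"
      using assms by (cases "i = k"; cases "j = l"; simp add: g)
    ultimately show "weyl n g i j k l y = 0 + (weyl_eigenvalue i j * ((if i = l \<and> j = k then 1 else 0)
        - (if i = k \<and> j = l then 1 else 0))) * exp (2 * (w i + w j) * y 0)"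
      using assms unfolding e by (simp only: weyl_eq left_diff_distrib add_0 mult.assoc)
  qed
  then show ?thesis by (simp only: pd_exp_first_coord) simp
qed

text \<open>
  The radial derivative vanishes: along \<open>\<partial>\<^sub>0\<close> each fiber direction is scaled by its own
  exponent, and \<open>W\<close> pairs its indices off, so the derivative of the component cancels against
  the connection terms. For \<open>p > 0\<close> the connection acts as the infinitesimal rotation of the
  \<open>(0, p)\<close> plane with speed \<open>w p\<close>; the right-hand side is this rotation applied to the four
  slots of \<open>W\<close>.
\<close>

lemma cov_weyl_eq:
  assumes "p < n" "i < n" "j < n" "k < n" "l < n"
  shows "cov_weyl n g p i j k l x =
      (if p = i then w p * exp (2 * w p * x 0) * weyl n g 0 j k l x else 0)
    + (if p = j then w p * exp (2 * w p * x 0) * weyl n g i 0 k l x else 0)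
    + (if p = k then w p * exp (2 * w p * x 0) * weyl n g i j 0 l x else 0)
    + (if p = l then w p * exp (2 * w p * x 0) * weyl n g i j k 0 x else 0)
    - (if i = 0 then w p * weyl n g p j k l x else 0)
    - (if j = 0 then w p * weyl n g i p k l x else 0)
    - (if k = 0 then w p * weyl n g i j p l x else 0)
    - (if l = 0 then w p * weyl n g i j k p x else 0)"
proof -
  \<comment> \<open>A nonzero component has \<open>{i, j} = {k, l}\<close>, so both pairs of exponents have the same sum.\<close>
  have "2 * (w i + w j) * weyl n g i j k l x = (w i + w j + w k + w l) * weyl n g i j k l x"
    using assms by (auto simp: weyl_eq g_eq)
  moreover have "w p = 0" if "p = 0" using that w_0 by simp
  ultimately show ?thesis
    unfolding cov_weyl_def sum.distrib
    using assms
    by (cases "p = 0") (simp_all add: pd_weyl sum_christoffel_upper algebra_simps split del: if_split cong: if_cong)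
qed

text \<open>
  In \<open>\<nabla>\<^sub>p W\<^sub>p\<^sub>j\<^sub>k\<^sub>l\<close> the rotation of the \<open>(0, p)\<close> plane moves the first slot, which produces
  the eigenvalue of the \<open>(0, j)\<close> plane, and moves \<open>\<partial>\<^sub>0\<close> to \<open>\<partial>\<^sub>p\<close> in the last two slots, which
  produces the eigenvalue of the \<open>(p, j)\<close> plane. The divergence therefore measures how far
  the Weyl eigenvalues are from being invariant under these rotations.
\<close>

lemma div_weyl_eq:
  assumes "j < n" "k < n" "l < n"
  shows "div_weyl n g j k l x =
    ((if l = 0 then g x j k else 0) - (if k = 0 then g x j l else 0)) *
    (\<Sum>p\<in>{..<n} - {j}. w p * (weyl_eigenvalue 0 j - weyl_eigenvalue p j))"
proof -
  have n: "0 < n" using assms by simp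
  define s where "s = ((if l = 0 then g x j k else 0) - (if k = 0 then g x j l else 0))"
  have "div_weyl n g j k l x = (\<Sum>p<n. exp (- (2 * w p * x 0)) * cov_weyl n g p p j k l x)"
    unfolding div_weyl_def
  proof (intro sum.cong refl)
    fix p assume "p \<in> {..<n}"
    then have "(\<Sum>i<n. ginv n g p i x * cov_weyl n g p i j k l x) =
      (\<Sum>i<n. (if p = i then exp (- (2 * w i * x 0)) else 0) * cov_weyl n g p i j k l x)"
      by (intro sum.cong) (auto simp: ginv_eq)
    then show "(\<Sum>i<n. ginv n g p i x * cov_weyl n g p i j k l x) = exp (- (2 * w p * x 0)) * cov_weyl n g p p j k l x"
      using \<open>p \<in> {..<n}\<close> by (simp add: sum_diagonal)
  qed
  also have "\<dots> = (\<Sum>p<n. if p = j then 0 else s * (w p * (weyl_eigenvalue 0 j - weyl_eigenvalue p j)))"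
  proof (intro sum.cong refl)
    fix p assume "p \<in> {..<n}"
    then have p: "p < n" by simp
    consider "p = 0" | "p \<noteq> 0" "p = j" | "p \<noteq> 0" "p \<noteq> j" by blast
    then show "exp (- (2 * w p * x 0)) * cov_weyl n g p p j k l x =
        (if p = j then 0 else s * (w p * (weyl_eigenvalue 0 j - weyl_eigenvalue p j)))"
    proof cases
      case 1
      then show ?thesis using assms n w_0 by (simp add: cov_weyl_eq)
    next
      case 2
      then show ?thesis using assms n
        by (simp add: cov_weyl_eq weyl_eq weyl_eigenvalue_commute[of _ 0] algebra_simps)
    next
      case 3
      define e where "e = exp (2 * w p * x 0)"
      have e: "e \<noteq> 0" "exp (- (2 * w p * x 0)) = inverse e" by (simp_all add: e_def exp_minus)
      have pp: "g x p p = e" using p by (simp add: g_eq e_def)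
      have off: "g x a b = 0" if "a \<noteq> b" "a < n" "b < n" for a b using that by (simp add: g_eq)
      have g_00: "g x 0 0 = 1" using n w_0 by (simp add: g_eq)
      have "weyl n g 0 j k l x = weyl_eigenvalue 0 j * s"
        using assms n g_00 off[of 0 l] off[of 0 k] by (simp add: weyl_eq s_def)
      moreover have "(if p = k then weyl n g p j 0 l x else 0) + (if p = l then weyl n g p j k 0 x else 0) = 0"
        using assms n p 3 by (cases "p = k"; cases "p = l") (simp_all add: weyl_eq off algebra_simps)
      moreover have "(if k = 0 then weyl n g p j p l x else 0) + (if l = 0 then weyl n g p j k p x else 0) =
          e * weyl_eigenvalue p j * s"
        using assms n p 3 off[of j p] by (simp add: weyl_eq pp s_def algebra_simps)
      moreover have "weyl n g p p k l x = 0"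
        using assms p by (simp add: weyl_eq)
      moreover have "cov_weyl n g p p j k l x = w p * e * weyl n g 0 j k l x
          + (if p = j then w p * e * weyl n g p 0 k l x else 0)
          + w p * e * ((if p = k then weyl n g p j 0 l x else 0) + (if p = l then weyl n g p j k 0 x else 0))
          - (if p = 0 then w p * weyl n g p j k l x else 0)
          - (if j = 0 then w p * weyl n g p p k l x else 0)
          - w p * ((if k = 0 then weyl n g p j p l x else 0) + (if l = 0 then weyl n g p j k p x else 0))"
        unfolding cov_weyl_eq[OF p p assms] e_def[symmetric] distrib_left
          if_distrib[where f = "\<lambda>u. w p * e * u"] if_distrib[where f = "\<lambda>u. w p * u"] by simp
      ultimately have "cov_weyl n g p p j k l x = w p * e * (weyl_eigenvalue 0 j * s) - w p * (e * weyl_eigenvalue p j * s)"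
        using 3 by (simp only: if_False if_cancel) simp
      then show ?thesis using 3 e(1) unfolding e(2) by (simp add: field_simps)
    qed
  qed
  also have "\<dots> = (\<Sum>p\<in>{..<n} - {j}. s * (w p * (weyl_eigenvalue 0 j - weyl_eigenvalue p j)))"
    by (intro sum.mono_neutral_cong_right) auto
  finally show ?thesis by (simp add: s_def sum_distrib_left)
qed

end

section \<open>Euclidean space as a Riemannian manifold\<close>

abbreviation \<delta> :: "nat \<Rightarrow> nat \<Rightarrow> real" where "\<delta> i j \<equiv> (if i = j then 1 else 0)"

definition euclid :: "nat \<Rightarrow> fiber" where
  "euclid m = \<lparr>mtop = Euclidean_space m, mdim = m, charts = {0},
     cdom = (\<lambda>_. topspace (Euclidean_space m)), cmap = (\<lambda>_ x. x), gcomp = (\<lambda>_ x. \<delta>)\<rparr>"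

lemma euclid_simps [simp]:
  "mtop (euclid m) = Euclidean_space m" "mdim (euclid m) = m" "charts (euclid m) = {0}"
  "cdom (euclid m) c = topspace (Euclidean_space m)" "cmap (euclid m) c x = x"
  "gcomp (euclid m) c x = \<delta>" "cimg (euclid m) c = topspace (Euclidean_space m)"
  by (simp_all add: euclid_def cimg_def)

lemma cmap_euclid: "cmap (euclid m) c = (\<lambda>x. x)"
  by (simp add: euclid_def)

lemma transition_euclid:
  "x \<in> topspace (Euclidean_space m) \<Longrightarrow> transition (euclid m) c d x = x"
  by (simp add: transition_def cmap_euclid inv_into_f_f[of "\<lambda>x. x", simplified])

lemma fun_upd_Euclidean_space:
  "x \<in> topspace (Euclidean_space m) \<Longrightarrow> i < m \<Longrightarrow> x(i := t) \<in> topspace (Euclidean_space m)"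
  by (simp add: topspace_Euclidean_space)

lemma pd_cong_Euclidean_space:
  assumes "\<And>x. x \<in> topspace (Euclidean_space m) \<Longrightarrow> f x = f' x"
    and "x \<in> topspace (Euclidean_space m)" "i < m"
  shows "pd i f x = pd i f' x"
  using assms by (simp add: pd_def fun_upd_Euclidean_space)

text \<open>
  The transition map of the chart is the identity only on \<open>\<real>\<^sup>m\<close>; outside it, the inverse of the
  chart has an unspecified value. Partial derivatives in the directions below \<open>m\<close> do not leave
  \<open>\<real>\<^sup>m\<close>, so smoothness there can be checked on any function with the same restriction.
\<close>

lemma smooth_on_cong_Euclidean_space:
  assumes eq: "\<And>x. x \<in> topspace (Euclidean_space m) \<Longrightarrow> f x = f' x"
    and f': "smooth_on m (topspace (Euclidean_space m)) f'"
  shows "smooth_on m (topspace (Euclidean_space m)) f"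
proof -
  have *: "foldr pd is f x = foldr pd is f' x"
    if "set is \<subseteq> {..<m}" "x \<in> topspace (Euclidean_space m)" for "is" x
    using that
  proof (induction "is" arbitrary: x)
    case (Cons i js)
    then show ?case by (auto intro: pd_cong_Euclidean_space)
  qed (simp add: eq)
  show ?thesis
    unfolding smooth_on_def
  proof (intro allI impI conjI ballI)
    fix "is" assume is': "set is \<subseteq> {..<m}"
    then have "continuous_map (subtopology (Euclidean_space m) (topspace (Euclidean_space m)))
        euclideanreal (foldr pd is f')"
      using f' by (auto simp: smooth_on_def)
    then show "continuous_map (subtopology (Euclidean_space m) (topspace (Euclidean_space m)))
        euclideanreal (foldr pd is f)"
      by (rule continuous_map_eq) (simp add: * is')
    fix x i assume "x \<in> topspace (Euclidean_space m)" "i < m"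
    moreover from this have "(\<lambda>t. foldr pd is f' (x(i := t))) field_differentiable at (x i)"
      using f' is' by (auto simp: smooth_on_def)
    ultimately show "(\<lambda>t. foldr pd is f (x(i := t))) field_differentiable at (x i)"
      by (simp add: * is' fun_upd_Euclidean_space)
  qed
qed

lemma pd_const: "pd i (\<lambda>x. c) = (\<lambda>x. 0)"
  by (simp add: pd_def fun_eq_iff)

lemma pd_coordinate: "pd i (\<lambda>x. x a) = (\<lambda>x. \<delta> i a)"
  by (auto simp: pd_def fun_eq_iff)

lemma smooth_on_const: "smooth_on m U (\<lambda>x. c)"
  unfolding smooth_on_def
proof (intro allI impI)
  fix js
  have "\<exists>c'. foldr pd js (\<lambda>x. c) = (\<lambda>x. c')"
    by (induction js) (auto simp: pd_const)
  then show "continuous_map (subtopology (Euclidean_space m) U) euclideanreal (foldr pd js (\<lambda>x. c)) \<and>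
      (\<forall>x\<in>U. \<forall>i<m. (\<lambda>t. foldr pd js (\<lambda>x. c) (x(i := t))) field_differentiable at (x i))"
    by auto
qed

lemma smooth_on_coordinate: "smooth_on m U (\<lambda>x. x a)"
  unfolding smooth_on_def
proof (intro allI impI)
  fix js
  have "foldr pd js (\<lambda>x. x a) = (\<lambda>x. x a) \<or> (\<exists>c. foldr pd js (\<lambda>x. x a) = (\<lambda>x. c))"
    by (induction js) (auto simp: pd_const pd_coordinate)
  moreover have "continuous_map (subtopology (Euclidean_space m) U) euclideanreal (\<lambda>x. x a)"
    unfolding Euclidean_space_def
    by (intro continuous_map_from_subtopology continuous_map_product_projection) simp
  moreover have "(\<lambda>t. (x(i := t)) a) field_differentiable at (x i)" for x :: "nat \<Rightarrow> real" and i
    by (cases "a = i") (simp_all add: field_differentiable_ident field_differentiable_const)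
  ultimately show "continuous_map (subtopology (Euclidean_space m) U) euclideanreal (foldr pd js (\<lambda>x. x a)) \<and>
      (\<forall>x\<in>U. \<forall>i<m. (\<lambda>t. foldr pd js (\<lambda>x. x a) (x(i := t))) field_differentiable at (x i))"
    by auto
qed

text \<open>The traces on \<open>\<real>\<^sup>m\<close> of a countable basis of the product topology form a basis.\<close>

lemma second_countable_Euclidean_space: "second_countable_top (Euclidean_space m)"
proof -
  obtain B :: "(nat \<Rightarrow> real) set set" where B: "countable B" "topological_basis B"
    using ex_countable_basis by blast
  define S where "S = {x::nat \<Rightarrow> real. \<forall>i\<ge>m. x i = 0}"
  have open_iff: "openin (Euclidean_space m) V \<longleftrightarrow> (\<exists>T. open T \<and> V = T \<inter> S)" for V
    by (simp add: Euclidean_space_def euclidean_product_topology openin_subtopology S_def)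
  show ?thesis unfolding second_countable_top_def
  proof (intro exI conjI)
    show "countable ((\<lambda>V. V \<inter> S) ` B)" using B by simp
    show "\<forall>V\<in>(\<lambda>V. V \<inter> S) ` B. openin (Euclidean_space m) V"
      using B topological_basis_open by (auto simp: open_iff)
    show "\<forall>U x. openin (Euclidean_space m) U \<and> x \<in> U \<longrightarrow> (\<exists>V\<in>(\<lambda>V. V \<inter> S) ` B. x \<in> V \<and> V \<subseteq> U)"
    proof (intro allI impI)
      fix U x assume "openin (Euclidean_space m) U \<and> x \<in> U"
      then obtain T where T: "open T" "U = T \<inter> S" "x \<in> T" "x \<in> S" by (auto simp: open_iff)
      then obtain V where "V \<in> B" "x \<in> V" "V \<subseteq> T" using B(2) topological_basisE by blast
      with T show "\<exists>V\<in>(\<lambda>V. V \<inter> S) ` B. x \<in> V \<and> V \<subseteq> U" by (intro bexI[of _ "V \<inter> S"]) auto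
    qed
  qed
qed

lemma connected_riemannian_manifold_euclid: "connected_riemannian_manifold (euclid m)"
proof -
  let ?T = "topspace (Euclidean_space m)"
  have transition: "smooth_on m ?T (\<lambda>x. transition (euclid m) c d x a)" for c d a
    by (rule smooth_on_cong_Euclidean_space[OF _ smooth_on_coordinate]) (simp add: transition_euclid)
  have pd_transition: "pd i (\<lambda>x. transition (euclid m) c d x a) x = \<delta> i a"
    if "x \<in> ?T" "i < m" for c d a x i
    using pd_cong_Euclidean_space[of m "\<lambda>x. transition (euclid m) c d x a" "\<lambda>x. x a" x i] that
    by (simp add: transition_euclid pd_coordinate)
  have "smooth_manifold (euclid m)"
    by (simp add: smooth_manifold_def second_countable_Euclidean_space Hausdorff_Euclidean_space
        cmap_euclid transition homeomorphic_map_id[unfolded id_def])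
  moreover have "metric_tensor (euclid m)"
  proof -
    have pos: "0 < (\<Sum>i<m. \<Sum>j<m. \<delta> i j * v i * v j)" if "\<exists>i<m. v i \<noteq> 0" for v :: "nat \<Rightarrow> real"
    proof -
      have "(\<Sum>i<m. \<Sum>j<m. \<delta> i j * v i * v j) = (\<Sum>i<m. (v i)\<^sup>2)"
        by (simp add: if_distrib[of "\<lambda>u. u * _"] power2_eq_square cong: if_cong)
      moreover from that obtain i where "i < m" "v i \<noteq> 0" by blast
      then have "(\<Sum>i<m. (v i)\<^sup>2) > 0" by (intro sum_pos2[of _ i]) auto
      ultimately show ?thesis by (simp only:)
    qed
    have pullback: "\<delta> i j = (\<Sum>a<m. \<Sum>b<m. \<delta> i a * \<delta> j b * \<delta> a b)" if "i < m" "j < m" for i j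
      using that by (simp add: if_distrib[of "\<lambda>u. u * _"] if_distrib[of "\<lambda>u. _ * u"] cong: if_cong)
    show ?thesis
      unfolding metric_tensor_def euclid_simps Int_absorb
    proof (intro conjI ballI allI impI)
      fix v :: "nat \<Rightarrow> real"
      assume "\<exists>i<m. v i \<noteq> 0"
      then show "0 < (\<Sum>i<m. \<Sum>j<m. \<delta> i j * v i * v j)" by (rule pos)
    next
      fix c d :: nat and p :: "nat \<Rightarrow> real" and i j
      assume "p \<in> ?T" "i < m" "j < m"
      then show "\<delta> i j = (\<Sum>a<m. \<Sum>b<m. pd i (\<lambda>x. transition (euclid m) c d x a) p *
          pd j (\<lambda>x. transition (euclid m) c d x b) p * \<delta> a b)"
        by (simp only: pd_transition pullback[symmetric])
    qed (simp_all only: smooth_on_const eq_commute)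
  qed
  moreover have "?T \<noteq> {}" by (auto simp: topspace_Euclidean_space)
  ultimately show ?thesis
    by (simp add: connected_riemannian_manifold_def connected_Euclidean_space)
qed

text \<open>The Euclidean metric is the exponential metric with all exponents \<open>0\<close>.\<close>

lemma flat_euclid: "flat (euclid m)"
proof -
  interpret exponential_diagonal_metric m "\<lambda>_. 0" "\<lambda>x. \<delta>"
    by unfold_locales auto
  have "gcomp (euclid m) c = (\<lambda>x. \<delta>)" for c by (simp add: euclid_def)
  then show ?thesis by (simp add: flat_def riem_dn_eq sec_curv_def)
qed

section \<open>Products of the line with two planes\<close>

text \<open>
  The first fiber has exponent \<open>1\<close> and the second has exponent \<open>b\<close>; both examples are
  instances of this family.
\<close>

definition exp_warping :: "real \<Rightarrow> nat \<Rightarrow> real \<Rightarrow> real" where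
  "exp_warping b i s = exp ((if i = 0 then 1 else b) * s)"

abbreviation exp_product :: "real \<Rightarrow> (real \<times> (nat \<Rightarrow> nat \<Rightarrow> real), nat \<Rightarrow> nat) riem" where
  "exp_product b \<equiv> multiply_warped_product UNIV 2 (\<lambda>_. euclid 2) (exp_warping b)"

lemma smooth_real_on_exp: "smooth_real_on I (\<lambda>s. exp (c * s))"
proof -
  have "(deriv ^^ m) (\<lambda>s. exp (c * s)) = (\<lambda>s. c ^ m * exp (c * s))" for m
  proof (induction m)
    case (Suc m)
    have "((\<lambda>s. c ^ m * exp (c * s)) has_real_derivative c ^ Suc m * exp (c * s)) (at s)" for s
      by (auto intro!: derivative_eq_intros)
    then show ?case by (simp add: Suc fun_eq_iff DERIV_imp_deriv)
  qed simp
  moreover have "(\<lambda>s. c ^ m * exp (c * s)) field_differentiable at s" for m s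
    unfolding field_differentiable_def by (rule exI) (auto intro!: derivative_eq_intros)
  ultimately show ?thesis by (simp add: smooth_real_on_def)
qed

lemma exp_warping_not_proportional:
  assumes "b \<noteq> 1" "i < 2" "j < 2" "i \<noteq> j"
  shows "\<not> (\<exists>a>0. \<forall>s\<in>UNIV. exp_warping b i s = a * exp_warping b j s)"
proof
  assume "\<exists>a>0. \<forall>s\<in>UNIV. exp_warping b i s = a * exp_warping b j s"
  then obtain a where a: "\<And>s. exp_warping b i s = a * exp_warping b j s" by auto
  have "a = 1" using a[of 0] by (simp add: exp_warping_def)
  with a[of 1] assms show False
    by (auto simp: exp_warping_def less_2_cases_iff)
qed

lemma warped_product_data_exp:
  assumes "b \<noteq> 1"
  shows "warped_product_data UNIV 2 (\<lambda>_. euclid 2) (exp_warping b)"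
proof -
  have "exp_warping b i = (\<lambda>s. exp ((if i = 0 then 1 else b) * s))" for i
    by (simp add: fun_eq_iff exp_warping_def)
  then have "smooth_real_on UNIV (exp_warping b i)" for i
    by (simp only: smooth_real_on_exp)
  moreover have "0 < exp_warping b i s" for i s
    by (simp add: exp_warping_def)
  ultimately show ?thesis
    using exp_warping_not_proportional[OF assms]
    by (simp add: warped_product_data_def connected_riemannian_manifold_euclid)
qed

lemma mdim_exp_product: "mdim (exp_product b) = 5"
  by (simp add: multiply_warped_product_def)

definition exponents :: "real \<Rightarrow> nat \<Rightarrow> real" where
  "exponents b i = (if i = 0 then 0 else if i < 3 then 1 else b)"

lemma less_5_cases: "(i::nat) < 5 \<longleftrightarrow> i = 0 \<or> i = 1 \<or> i = 2 \<or> i = 3 \<or> i = 4"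
  by auto

lemma lessThan_5: "{..<5::nat} = {0, 1, 2, 3, 4}"
  by auto

text \<open>
  Every product chart carries the same components, so the curvature formulas for diagonal
  exponential metrics apply in each chart.
\<close>

lemma exp_product_metric:
  "exponential_diagonal_metric 5 (exponents b) (gcomp (exp_product b) c)"
proof
  show "exponents b 0 = 0" by (simp add: exponents_def)
  fix x :: "nat \<Rightarrow> real" and i j :: nat
  assume "i < 5" "j < 5"
  have *: "{..<2::nat} = {0, 1}" "block (\<lambda>_. euclid 2) 0 = {1, 2}" "block (\<lambda>_. euclid 2) 1 = {3, 4}"
    "offset (\<lambda>_. euclid 2) 0 = 1" "offset (\<lambda>_. euclid 2) 1 = 3"
    by (auto simp: block_def offset_def)
  have sq: "(exp (a * t))\<^sup>2 = exp (2 * a * t)" for a t :: real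
    by (simp add: exp_double[symmetric] mult.assoc)
  have "gcomp (exp_product b) c x i j = (if i = 0 \<and> j = 0 then 1 else 0)
      + (if i \<in> {1, 2} \<and> j \<in> {1, 2} then exp (2 * 1 * x 0) * \<delta> (i - 1) (j - 1) else 0)
      + (if i \<in> {3, 4} \<and> j \<in> {3, 4} then exp (2 * b * x 0) * \<delta> (i - 3) (j - 3) else 0)"
    using sq[of 1 "x 0"] sq[of b "x 0"]
    by (simp add: multiply_warped_product_def * exp_warping_def del: One_nat_def)
  with \<open>i < 5\<close> \<open>j < 5\<close> show "gcomp (exp_product b) c x i j =
      (if i = j then exp (2 * exponents b i * x 0) else 0)"
    unfolding less_5_cases exponents_def by (elim disjE) simp_all
qed

lemma exp_product_chart:
  obtains c x where "c \<in> charts (exp_product b)" "x \<in> cimg (exp_product b) c"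
proof -
  have "(\<lambda>i\<in>{..<2}. 0) \<in> charts (exp_product b)"
    by (simp add: multiply_warped_product_def)
  moreover have "cimg (exp_product b) c \<noteq> {}" for c
    by (simp add: cimg_def multiply_warped_product_def PiE_eq_empty_iff topspace_Euclidean_space exI[of _ "\<lambda>_. 0"])
  ultimately show ?thesis using that by blast
qed

section \<open>The two examples\<close>

lemma exp_product_ricci_eigenvalue:
  assumes "exponential_diagonal_metric 5 (exponents b) g" and "i < 5"
  shows "exponential_diagonal_metric.ricci_eigenvalue 5 (exponents b) i =
    (if i = 0 then - 2 - 2 * b\<^sup>2 else if i < 3 then - 2 - 2 * b else - 2 * b\<^sup>2 - 2 * b)"
proof -
  interpret exponential_diagonal_metric 5 "exponents b" g by fact
  show ?thesis using \<open>i < 5\<close> unfolding less_5_cases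
    by (elim disjE) (simp_all add: ricci_eigenvalue_def lessThan_5 insert_Diff_if sec_curv_def exponents_def power2_eq_square)
qed

text \<open>
  For \<open>b = 0\<close> only the directions \<open>p = 1, 2\<close> have a nonzero exponent. Together with \<open>\<partial>\<^sub>0\<close> they
  span the tangent space of the factor \<open>H\<^sup>3\<close>, which is isotropic; hence for
  \<open>j \<noteq> 0\<close> the planes \<open>(0, j)\<close> and \<open>(p, j)\<close> have equal Weyl eigenvalues, and the divergence vanishes term by term.
\<close>

lemma harmonic_exp_product_0: "harmonic_weyl (exp_product 0)"
proof -
  have "div_weyl 5 (gcomp (exp_product 0) c) j k l x = 0" if "j < 5" "k < 5" "l < 5" for c j k l x
  proof -
    interpret exponential_diagonal_metric 5 "exponents 0" "gcomp (exp_product 0) c"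
      by (rule exp_product_metric)
    note ricci_eigenvalue = exp_product_ricci_eigenvalue[OF exp_product_metric, of _ 0]
    show ?thesis
    proof (cases "j = 0")
      \<comment> \<open>Isotropy concerns \<open>j \<noteq> 0\<close> only; for \<open>j = 0\<close> the tensor factor is antisymmetric in
        \<open>k, l\<close> and supported on \<open>k = l = 0\<close>.\<close>
      case True
      with that show ?thesis by (simp add: div_weyl_eq g_eq)
    next
      case False
      have "(\<Sum>p\<in>{..<5} - {j}. exponents 0 p * (weyl_eigenvalue 0 j - weyl_eigenvalue p j)) = 0"
        using \<open>j < 5\<close> False unfolding less_5_cases
        by (elim disjE) (simp_all add: lessThan_5 insert_Diff_if weyl_eigenvalue_def sec_curv_def ricci_eigenvalue exponents_def)
      with that show ?thesis by (simp add: div_weyl_eq)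
    qed
  qed
  then show ?thesis by (simp add: harmonic_weyl_def mdim_exp_product)
qed

lemma not_zero_radial_exp_product_0: "\<not> zero_radial_weyl UNIV 2 (\<lambda>_. euclid 2) (exp_warping 0)"
proof
  obtain c x where cx: "c \<in> charts (exp_product 0)" "x \<in> cimg (exp_product 0) c"
    by (rule exp_product_chart)
  interpret exponential_diagonal_metric 5 "exponents 0" "gcomp (exp_product 0) c"
    by (rule exp_product_metric)
  note ricci_eigenvalue = exp_product_ricci_eigenvalue[OF exp_product_metric, of _ 0]
  assume "zero_radial_weyl UNIV 2 (\<lambda>_. euclid 2) (exp_warping 0)"
  then have "weyl 5 (gcomp (exp_product 0) c) 0 1 1 0 x = 0"
    using cx by (simp add: zero_radial_weyl_def mdim_exp_product Let_def)
  moreover have "weyl_eigenvalue 0 1 = - 1 / 6"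
    by (simp add: weyl_eigenvalue_def sec_curv_def ricci_eigenvalue exponents_def scalar_curv_def lessThan_5)
  ultimately show False by (simp add: weyl_eq g_eq)
qed

text \<open>
  For \<open>b = - 1\<close> the radial planes all have sectional curvature \<open>- 1\<close> and the directions along
  the fibers are Ricci flat, so the four radial Weyl eigenvalues agree; their sum is zero because
  \<open>W\<close> is trace free.
\<close>

lemma zero_radial_exp_product_minus_1: "zero_radial_weyl UNIV 2 (\<lambda>_. euclid 2) (exp_warping (- 1))"
proof -
  have "weyl 5 (gcomp (exp_product (- 1)) c) 0 j k l x = 0" if "j < 5" "k < 5" "l < 5" for c j k l x
  proof -
    interpret exponential_diagonal_metric 5 "exponents (- 1)" "gcomp (exp_product (- 1)) c"
      by (rule exp_product_metric)
    note ricci_eigenvalue = exp_product_ricci_eigenvalue[OF exp_product_metric, of _ "- 1"]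
    have "weyl_eigenvalue 0 j = 0 \<or> j = 0"
      using \<open>j < 5\<close> unfolding less_5_cases
      by (elim disjE) (simp_all add: weyl_eigenvalue_def sec_curv_def ricci_eigenvalue exponents_def scalar_curv_def lessThan_5)
    then show ?thesis using that by (auto simp: weyl_eq)
  qed
  then show ?thesis by (simp add: zero_radial_weyl_def mdim_exp_product Let_def)
qed

text \<open>
  With zero radial eigenvalues, the divergence in the direction \<open>1\<close> is \<open>-\<close> the sum of
  \<open>w p * weyl_eigenvalue p 1\<close>. The plane of the first fiber has eigenvalue \<open>- 4/3\<close> and
  exponent \<open>1\<close>, the planes \<open>(3, 1)\<close> and \<open>(4, 1)\<close> have eigenvalue \<open>2/3\<close> and exponent \<open>- 1\<close>, so
  all contributions have the same sign.
\<close>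

lemma not_harmonic_exp_product_minus_1: "\<not> harmonic_weyl (exp_product (- 1))"
proof
  obtain c x where cx: "c \<in> charts (exp_product (- 1))" "x \<in> cimg (exp_product (- 1)) c"
    by (rule exp_product_chart)
  interpret exponential_diagonal_metric 5 "exponents (- 1)" "gcomp (exp_product (- 1)) c"
    by (rule exp_product_metric)
  note ricci_eigenvalue = exp_product_ricci_eigenvalue[OF exp_product_metric, of _ "- 1"]
  assume "harmonic_weyl (exp_product (- 1))"
  then have "div_weyl 5 (gcomp (exp_product (- 1)) c) 1 1 0 x = 0"
    using cx by (simp add: harmonic_weyl_def mdim_exp_product)
  moreover have "(\<Sum>p\<in>{..<5} - {1}. exponents (- 1) p * (weyl_eigenvalue 0 1 - weyl_eigenvalue p 1)) = 8 / 3"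
    by (simp add: lessThan_5 insert_Diff_if weyl_eigenvalue_def sec_curv_def ricci_eigenvalue exponents_def scalar_curv_def)
  ultimately show False by (simp add: div_weyl_eq g_eq)
qed

theorem proposition2:
  shows "(\<exists>I k (N :: nat \<Rightarrow> fiber) h.
            warped_product_data I k N h \<and>
            4 \<le> mdim (multiply_warped_product I k N h) \<and>
            (\<forall>i<k. flat (N i)) \<and>
            harmonic_weyl (multiply_warped_product I k N h) \<and>
            \<not> zero_radial_weyl I k N h) \<and>
         (\<exists>I k (N :: nat \<Rightarrow> fiber) h.
            warped_product_data I k N h \<and>
            4 \<le> mdim (multiply_warped_product I k N h) \<and>
            (\<forall>i<k. flat (N i)) \<and>
            zero_radial_weyl I k N h \<and>
            \<not> harmonic_weyl (multiply_warped_product I k N h))"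
proof (intro conjI exI allI impI)
  show "warped_product_data UNIV 2 (\<lambda>_. euclid 2) (exp_warping 0)"
    "warped_product_data UNIV 2 (\<lambda>_. euclid 2) (exp_warping (- 1))"
    by (simp_all add: warped_product_data_exp)
qed (simp_all add: mdim_exp_product flat_euclid harmonic_exp_product_0 not_zero_radial_exp_product_0
    zero_radial_exp_product_minus_1 not_harmonic_exp_product_minus_1)

end
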